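(* Let $\mathcal{X}\subset\mathbb{R}^n$ be compact and let $\alpha\in[0,1]$ be a violation level such that $\mathcal{X}_\alpha\neq\emptyset$. Suppose that: (1) $\mathsf{Pr}_\xi\{\xi\in\mathsf{supp}\,p:\bar h(x,\xi)=0\}=0$ for each $x\in\mathcal{X}$; (2) there exists $\mu^*\in A_\alpha$ such that for any $\delta>0$ there exists a probability measure $\mu\in M(\mathcal{X})$, different from $\mu^*$, with $\int_{\mathcal{X}}\mathbb{P}(x)\,d\mu>1-\alpha$ and $\left|\int_{\mathcal{X}}J(x)\,d\mu-\int_{\mathcal{X}}J(x)\,d\mu^*\right|\le\delta$; (3) for any $\beta\in(0,1]$ there exists a globally optimal solution $\bar x_\beta$ of the problem $\min\{J(x):x\in\mathcal{X},\ \mathbb{P}(x)\ge 1-\beta\}$ such that for any $\eta>0$ there is an $x\in\mathcal{X}$ satisfying $\|x-\bar x_\beta\|\le\eta$ and $\mathbb{P}(x)>1-\beta$. Let $\gamma=0$. Then, as $N\to\infty$ and $\varepsilon\to 0$, with probability 1, $$\tilde{\mathcal{J}}^{\gamma,\varepsilon}_{\alpha}(\mathcal{D}_N)\to\mathcal{J}^*_\alpha\quad\text{and}\quad \mathbb{D}\left(\tilde D^{\gamma,\varepsilon}_{\alpha}(\mathcal{D}_N),D_\alpha\right)\to 0,$$ where $\mathbb{D}(Z_1,Z_2):=\sup_{z\in Z_1}\inf_{z'\in Z_2}\|z-z'\|$ is the deviation of the set $Z_1$ from the set $Z_2$.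
   Context: Setting: $J:\mathcal{X}\to\mathbb{R}$ is continuous. $\xi$ is a random variable with values in $\Xi\subseteq\mathbb{R}^s$ having a continuous probability density $p$ with support $\Xi$; $\mathsf{Pr}_\xi$ denotes its law, and $\mathsf{supp}\,p$ is the closure of $\{\xi\in\Xi:p(\xi)>0\}$. $h=(h_1,\dots,h_m):\mathcal{X}\times\Xi\to\mathbb{R}^m$ is continuous, and $\bar h(x,\xi):=\max_{i=1,\dots,m}h_i(x,\xi)$. With $\mathbb{I}\{y\}=1$ if $y\le 0$ and $\mathbb{I}\{y\}=0$ otherwise, $\mathbb{P}(x):=\int_{\Xi}\mathbb{I}\{\bar h(x,\xi)\}p(\xi)\,d\xi$. Put $\mathcal{X}_\alpha:=\{x\in\mathcal{X}:\mathbb{P}(x)\ge 1-\alpha\}$. $M(\mathcal{X})$ is the set of all Borel probability measures on $\mathcal{X}$, $M_\alpha(\mathcal{X}):=\{\mu\in M(\mathcal{X}):\int_{\mathcal{X}}\mathbb{P}(x)\,d\mu\ge 1-\alpha\}$, $\mathcal{J}^*_\alpha:=\inf_{\mu\in M_\alpha(\mathcal{X})}\int_{\mathcal{X}}J(x)\,d\mu$, and $A_\alpha:=\{\mu\in M_\alpha(\mathcal{X}):\int_{\mathcal{X}}J(x)\,d\mu=\mathcal{J}^*_\alpha\}$. Two-point problem: let $\mathcal{U}_{\mathsf{m}}:=\{\mu_{\mathsf{m}}\in[0,1]^2:\mu_{\mathsf{m}}^{(1)}+\mu_{\mathsf{m}}^{(2)}=1\}$, $\mathcal{Z}_{\mathsf{m}}:=\mathcal{U}_{\mathsf{m}}\times\mathcal{X}^2$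 with elements $\boldsymbol{z}_{\mathsf{m}}=(\mu_{\mathsf{m}}^{(1)},\mu_{\mathsf{m}}^{(2)},x^{(1)},x^{(2)})$, $\mathcal{J}_{\mathsf{m}}(\boldsymbol{z}_{\mathsf{m}}):=\sum_{i=1}^2J(x^{(i)})\mu_{\mathsf{m}}^{(i)}$, and $\mathcal{Z}_{\mathsf{m},\alpha}:=\{\boldsymbol{z}_{\mathsf{m}}\in\mathcal{Z}_{\mathsf{m}}:\sum_{i=1}^2\mathbb{P}(x^{(i)})\mu_{\mathsf{m}}^{(i)}\ge 1-\alpha\}$. $D_\alpha$ is the set of minimizers of $\mathcal{J}_{\mathsf{m}}$ over $\mathcal{Z}_{\mathsf{m},\alpha}$. Sample-based smooth approximation: $\mathcal{D}_N=\{\xi^{(1)},\dots,\xi^{(N)}\}$ consists of $N$ i.i.d. samples of $\xi$. For $\varepsilon>0$, $\Lambda_\varepsilon(y)=0$ if $y\ge\varepsilon$, $\Lambda_\varepsilon(y)=\lambda_\varepsilon(y)$ if $-\varepsilon<y<\varepsilon$, and $\Lambda_\varepsilon(y)=1$ otherwise, where $\lambda_\varepsilon:[-\varepsilon,\varepsilon]\to[0,1]$ is a smooth, strictly decreasing function, symmetric in the sense that $\Lambda_\varepsilon(-y)=1-\Lambda_\varepsilon(y)$, chosen such that $\Lambda_\varepsilon$ is continuously differentiable. For a parameter $\gamma$, $\tilde{\mathbb{P}}^{\gamma,\varepsilon}_N(x):=\frac1N\sum_{j=1}^N\Lambda_\varepsilon(\bar h(x,\xi^{(j)})+\gamma)$.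 For a level $\alpha'$, $\mathcal{Z}^{\gamma,\varepsilon}_{\mathsf{m},\alpha'}(\mathcal{D}_N):=\{\boldsymbol{z}_{\mathsf{m}}\in\mathcal{Z}_{\mathsf{m}}:\sum_{i=1}^2\tilde{\mathbb{P}}^{\gamma,\varepsilon}_N(x^{(i)})\mu_{\mathsf{m}}^{(i)}\ge 1-\alpha'\}$, $\tilde{\mathcal{J}}^{\gamma,\varepsilon}_{\alpha'}(\mathcal{D}_N):=\min\{\mathcal{J}_{\mathsf{m}}(\boldsymbol{z}_{\mathsf{m}}):\boldsymbol{z}_{\mathsf{m}}\in\mathcal{Z}^{\gamma,\varepsilon}_{\mathsf{m},\alpha'}(\mathcal{D}_N)\}$, and $\tilde D^{\gamma,\varepsilon}_{\alpha'}(\mathcal{D}_N)$ is the corresponding set of minimizers. In the claim these are used with $\alpha'=\alpha$ and $\gamma=0$. *)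

theory Defs
  imports "HOL-Probability.Probability"
begin

definition hbar :: "('x \<Rightarrow> 's \<Rightarrow> real ^ 'm) \<Rightarrow> 'x \<Rightarrow> 's \<Rightarrow> real" where
  "hbar h x \<xi> = Max (range (\<lambda>i. h x \<xi> $ i))"

(* The indicator of y \<le> 0, as a real number. *)
definition le0_ind :: "real \<Rightarrow> real" where
  "le0_ind y = (if y \<le> 0 then 1 else 0)"

(* p only matters on Xi; outside Xi its values are arbitrary, so the density of the law
   is cut off there. *)
definition dens :: "(real ^ 's) set \<Rightarrow> (real ^ 's \<Rightarrow> real) \<Rightarrow> real ^ 's \<Rightarrow> ennreal" where
  "dens \<Xi> p \<xi> = ennreal (p \<xi>) * indicator \<Xi> \<xi>"

definition law :: "(real ^ 's) set \<Rightarrow> (real ^ 's \<Rightarrow> real) \<Rightarrow> (real ^ 's) measure" where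
  "law \<Xi> p = density lborel (dens \<Xi> p)"

definition supp :: "(real ^ 's) set \<Rightarrow> (real ^ 's \<Rightarrow> real) \<Rightarrow> (real ^ 's) set" where
  "supp \<Xi> p = closure {\<xi>\<in>\<Xi>. p \<xi> > 0}"

definition sat_prob ::
  "(real ^ 's) set \<Rightarrow> (real ^ 's \<Rightarrow> real) \<Rightarrow> ('x \<Rightarrow> real ^ 's \<Rightarrow> real ^ 'm) \<Rightarrow> 'x \<Rightarrow> real" where
  "sat_prob \<Xi> p h x = (LINT \<xi>:\<Xi>|lborel. le0_ind (hbar h x \<xi>) * p \<xi>)"

(* In the following definitions P is a function of the decision variable: the satisfaction
   probability itself, or its sample-based smooth approximation. *)
definition feasible :: "'x set \<Rightarrow> ('x \<Rightarrow> real) \<Rightarrow> real \<Rightarrow> 'x set" where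
  "feasible X P \<alpha> = {x\<in>X. P x \<ge> 1 - \<alpha>}"

definition minimizers :: "('z \<Rightarrow> real) \<Rightarrow> 'z set \<Rightarrow> 'z set" where
  "minimizers f S = {z. is_arg_min f (\<lambda>z. z \<in> S) z}"

definition prob_measures_on :: "'x::topological_space set \<Rightarrow> 'x measure set" where
  "prob_measures_on X = {\<mu>. prob_space \<mu> \<and> sets \<mu> = sets (restrict_space borel X)}"

definition feasible_measures ::
  "'x::topological_space set \<Rightarrow> ('x \<Rightarrow> real) \<Rightarrow> real \<Rightarrow> 'x measure set" where
  "feasible_measures X P \<alpha> = {\<mu>\<in>prob_measures_on X. (LINT x|\<mu>. P x) \<ge> 1 - \<alpha>}"

(* Optimal values are extended reals, so an infeasible problem has the value \<infinity>. *)
definition opt_measure_val ::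
  "'x::topological_space set \<Rightarrow> ('x \<Rightarrow> real) \<Rightarrow> ('x \<Rightarrow> real) \<Rightarrow> real \<Rightarrow> ereal" where
  "opt_measure_val X J P \<alpha> = (INF \<mu>\<in>feasible_measures X P \<alpha>. ereal (LINT x|\<mu>. J x))"

definition opt_measures ::
  "'x::topological_space set \<Rightarrow> ('x \<Rightarrow> real) \<Rightarrow> ('x \<Rightarrow> real) \<Rightarrow> real \<Rightarrow> 'x measure set" where
  "opt_measures X J P \<alpha> =
     {\<mu>\<in>feasible_measures X P \<alpha>. ereal (LINT x|\<mu>. J x) = opt_measure_val X J P \<alpha>}"

(* A two-point element is a pair (weights, points). With the library norms on vectors and
   products, its norm is the Euclidean norm of all coordinates taken together. *)
type_synonym 'x two_point = "(real ^ 2) \<times> ('x ^ 2)"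

definition two_point_weights :: "(real ^ 2) set" where
  "two_point_weights = {\<mu>. (\<forall>i. \<mu> $ i \<in> {0..1}) \<and> \<mu> $ 1 + \<mu> $ 2 = 1}"

definition two_points :: "'x set \<Rightarrow> 'x two_point set" where
  "two_points X = two_point_weights \<times> {x. \<forall>i. x $ i \<in> X}"

definition two_point_mean :: "('x \<Rightarrow> real) \<Rightarrow> 'x two_point \<Rightarrow> real" where
  "two_point_mean f z = (\<Sum>i\<in>UNIV. f (snd z $ i) * fst z $ i)"

definition two_point_feasible :: "'x set \<Rightarrow> ('x \<Rightarrow> real) \<Rightarrow> real \<Rightarrow> 'x two_point set" where
  "two_point_feasible X P \<alpha> = {z\<in>two_points X. two_point_mean P z \<ge> 1 - \<alpha>}"

definition two_point_val ::
  "'x set \<Rightarrow> ('x \<Rightarrow> real) \<Rightarrow> ('x \<Rightarrow> real) \<Rightarrow> real \<Rightarrow> ereal" where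
  "two_point_val X J P \<alpha> = (INF z\<in>two_point_feasible X P \<alpha>. ereal (two_point_mean J z))"

definition two_point_minimizers ::
  "'x set \<Rightarrow> ('x \<Rightarrow> real) \<Rightarrow> ('x \<Rightarrow> real) \<Rightarrow> real \<Rightarrow> 'x two_point set" where
  "two_point_minimizers X J P \<alpha> = minimizers (two_point_mean J) (two_point_feasible X P \<alpha>)"

definition smooth_step :: "(real \<Rightarrow> real \<Rightarrow> real) \<Rightarrow> real \<Rightarrow> real \<Rightarrow> real" where
  "smooth_step lam \<epsilon> y =
     (if y \<ge> \<epsilon> then 0 else if -\<epsilon> < y \<and> y < \<epsilon> then lam \<epsilon> y else 1)"

(* Derivatives of all orders, one-sided at the boundary points of S. *)
definition smooth_within :: "real set \<Rightarrow> (real \<Rightarrow> real) \<Rightarrow> bool" where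
  "smooth_within S f \<longleftrightarrow>
     (\<exists>D :: nat \<Rightarrow> real \<Rightarrow> real. (\<forall>t\<in>S. D 0 t = f t) \<and>
        (\<forall>k. \<forall>t\<in>S. (D k has_real_derivative D (Suc k) t) (at t within S)))"

definition smoothing_family :: "(real \<Rightarrow> real \<Rightarrow> real) \<Rightarrow> bool" where
  "smoothing_family lam \<longleftrightarrow>
     (\<forall>\<epsilon>>0. lam \<epsilon> ` {-\<epsilon>..\<epsilon>} \<subseteq> {0..1} \<and>
        smooth_within {-\<epsilon>..\<epsilon>} (lam \<epsilon>) \<and>
        strict_antimono_on {-\<epsilon>..\<epsilon>} (lam \<epsilon>) \<and>
        (\<forall>y. smooth_step lam \<epsilon> (-y) = 1 - smooth_step lam \<epsilon> y) \<and>
        smooth_step lam \<epsilon> C1_differentiable_on UNIV)"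

(* The N samples are s 0, ..., s (N - 1). *)
definition sample_prob ::
  "(real \<Rightarrow> real \<Rightarrow> real) \<Rightarrow> ('x \<Rightarrow> 's \<Rightarrow> real ^ 'm) \<Rightarrow> real \<Rightarrow> real \<Rightarrow> nat \<Rightarrow> (nat \<Rightarrow> 's)
     \<Rightarrow> 'x \<Rightarrow> real" where
  "sample_prob lam h \<gamma> \<epsilon> N s x =
     (1 / real N) * (\<Sum>j<N. smooth_step lam \<epsilon> (hbar h x (s j) + \<gamma>))"

(* In extended reals the supremum over the empty set is -\<infinity>; hence a deviation that tends
   to 0 forces the first set to be eventually nonempty. *)
definition deviation :: "'z::real_normed_vector set \<Rightarrow> 'z set \<Rightarrow> ereal" where
  "deviation Z1 Z2 = (SUP z\<in>Z1. INF z'\<in>Z2. ereal (norm (z - z')))"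

end

theory Submission
  imports Defs
begin

text \<open>The statement combines three facts.

Stability. Let \<open>f\<close> be minimized over a compact set under a constraint \<open>g \<ge> c\<close>, and let \<open>g\<close> be
perturbed uniformly. Points that are feasible for the perturbed problem are nearly feasible for
the exact one, so by compactness they are not much better than the optimum, and if they are also
nearly optimal they are close to exact minimizers. Conversely, strictly feasible points with a nearly
optimal value stay feasible, so the perturbed optimal values are not much worse. This is
\<open>perturbed_constraint_stability\<close>.

Reduction to two points. For a probability measure \<open>\<mu>\<close> the pair of the means of \<open>J\<close> and \<open>P\<close> lies in the
convex hull of the compact planar set of all \<open>(J x, P x)\<close>, hence is a finite mixture of such points. Only the
two numbers \<open>1\<close> (total mass) and the mean of \<open>P\<close> have to be preserved, so by a linear programming argument two
points suffice to keep them without increasing the mean of \<open>J\<close>. Therefore the problem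
over measures and the two-point problem have the same value
(\<open>opt_measure_val_eq_two_point_val\<close>). The same reduction turns the measures of hypothesis
\<open>approx_measure\<close> into strictly feasible two-point elements of nearly optimal value, which is what stability
asks for.

Uniform strong law. Almost surely, the smoothed sample probabilities converge to \<open>P\<close> uniformly
on \<open>X\<close> as the sample size grows and the smoothing width shrinks
(\<open>AE_smoothed_frequency_uniform\<close>). Near a fixed \<open>x0\<close> the sign of the constraint function is locally
constant in \<open>x\<close>, except for parameters in an event of small probability, because the boundary \<open>hbar h x0 t = 0\<close> is null. By
compactness this reduces the uniform statement to the strong law for finitely many events. The
same argument shows that \<open>P\<close> is continuous. A mean over two points inherits the
uniform error bound, so that for each such sample sequence stability applies with the sample constraint as the perturbed one.\<close>

section \<open>Stability of minimization under uniform perturbation of a constraint\<close>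

lemma minimizers_iff: "z \<in> minimizers f S \<longleftrightarrow> z \<in> S \<and> (\<forall>y\<in>S. f z \<le> f y)"
  unfolding minimizers_def is_arg_min_def by (auto simp: not_less)

lemma compact_superlevel:
  fixes f :: "'z::real_normed_vector \<Rightarrow> real"
  assumes "compact Z" "continuous_on Z f"
  shows "compact {z\<in>Z. f z \<ge> c}"
proof -
  have "closedin (top_of_set Z) (Z \<inter> f -` {c..})"
    by (rule continuous_closedin_preimage) (use assms in auto)
  moreover have "Z \<inter> f -` {c..} = {z\<in>Z. f z \<ge> c}" by auto
  ultimately show ?thesis using closedin_compact[OF assms(1)] by simp
qed

text \<open>The points of \<open>Z\<close> at distance at least \<open>\<tau>\<close> from every minimizer form a compact set on which the
larger of the constraint violation \<open>c - g\<close> and the excess cost \<open>f - v\<close> is strictly positive: a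
point where both are at most \<open>0\<close> would itself be a minimizer. The minimum of this violation over the compact
set bounds how nearly feasible and nearly optimal a point far from the minimizers can be.\<close>

lemma near_optimal_near_minimizers:
  fixes f g :: "'z::real_normed_vector \<Rightarrow> real"
  assumes Z: "compact Z" and f: "continuous_on Z f" and g: "continuous_on Z g"
    and lower: "\<And>z. z \<in> Z \<Longrightarrow> g z \<ge> c \<Longrightarrow> v \<le> f z"
    and tau: "\<tau> > 0"
  obtains e where "e > 0"
    "\<And>z. z \<in> Z \<Longrightarrow> g z \<ge> c - e \<Longrightarrow> f z \<le> v + e \<Longrightarrow>
       \<exists>z'\<in>minimizers f {z\<in>Z. g z \<ge> c}. norm (z - z') < \<tau>"
proof -
  let ?D = "minimizers f {z\<in>Z. g z \<ge> c}"
  define S where "S = Z \<inter> (\<Inter>z'\<in>?D. {z. norm (z - z') \<ge> \<tau>})"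
  define \<phi> where "\<phi> z = max (c - g z) (f z - v)" for z
  have "compact S"
    unfolding S_def by (intro compact_Int_closed Z closed_INT ballI closed_Collect_le continuous_intros)
  have pos: "\<phi> z > 0" if "z \<in> S" for z
  proof (rule ccontr)
    assume "\<not> \<phi> z > 0"
    then have "g z \<ge> c" "f z \<le> v" unfolding \<phi>_def by auto
    then have "z \<in> ?D" using that lower unfolding minimizers_iff S_def by force
    then have "\<tau> \<le> norm (z - z)" using that unfolding S_def by blast
    then show False using tau by simp
  qed
  have "\<exists>e>0. \<forall>z\<in>S. e < \<phi> z"
  proof (cases "S = {}")
    case True then show ?thesis by (intro exI[of _ 1]) auto
  next
    case False
    have "continuous_on S \<phi>" unfolding \<phi>_def
      by (intro continuous_intros continuous_on_subset[OF f] continuous_on_subset[OF g]) (auto simp: S_def)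
    then obtain z0 where "z0 \<in> S" "\<forall>z\<in>S. \<phi> z0 \<le> \<phi> z"
      using continuous_attains_inf[OF \<open>compact S\<close> False] by blast
    then show ?thesis using pos[of z0] by (intro exI[of _ "\<phi> z0 / 2"]) force
  qed
  then obtain e where e: "e > 0" "\<And>z. z \<in> S \<Longrightarrow> e < \<phi> z" by blast
  show ?thesis
  proof (rule that[OF e(1)])
    fix z assume z: "z \<in> Z" "g z \<ge> c - e" "f z \<le> v + e"
    then have "\<not> e < \<phi> z" unfolding \<phi>_def by auto
    then have "z \<notin> S" using e(2) by blast
    then show "\<exists>z'\<in>?D. norm (z - z') < \<tau>" using z(1) unfolding S_def by (auto simp: not_le)
  qed
qed

text \<open>The same compactness argument for the value: on the compact set of points that beat \<open>v\<close> by at least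
\<open>\<delta>\<close> the constraint is violated, hence violated by a uniform amount.\<close>

lemma near_feasible_not_much_better:
  fixes f g :: "'z::real_normed_vector \<Rightarrow> real"
  assumes Z: "compact Z" and f: "continuous_on Z f" and g: "continuous_on Z g"
    and lower: "\<And>z. z \<in> Z \<Longrightarrow> g z \<ge> c \<Longrightarrow> v \<le> f z"
    and delta: "\<delta> > 0"
  obtains e where "e > 0" "\<And>z. z \<in> Z \<Longrightarrow> g z \<ge> c - e \<Longrightarrow> v - \<delta> < f z"
proof -
  define S where "S = {z\<in>Z. - f z \<ge> \<delta> - v}"
  have "compact S" unfolding S_def by (intro compact_superlevel Z continuous_intros f)
  have "\<exists>e>0. \<forall>z\<in>S. e < c - g z"
  proof (cases "S = {}")
    case True then show ?thesis by (intro exI[of _ 1]) auto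
  next
    case False
    have "continuous_on S g" by (rule continuous_on_subset[OF g]) (auto simp: S_def)
    then obtain z0 where z0: "z0 \<in> S" "\<forall>z\<in>S. g z \<le> g z0"
      using continuous_attains_sup[OF \<open>compact S\<close> False] by blast
    then have "g z0 < c" using lower[of z0] delta unfolding S_def by force
    then have "0 < (c - g z0) / 2 \<and> (\<forall>z\<in>S. (c - g z0) / 2 < c - g z)" using z0(2) by fastforce
    then show ?thesis by blast
  qed
  then obtain e where e: "e > 0" "\<And>z. z \<in> S \<Longrightarrow> e < c - g z" by blast
  then show ?thesis by (intro that[OF e(1)]) (force simp: S_def)
qed

text \<open>The perturbed feasible sets vary on both sides of the exact one. For the lower bound on the values and
for the distance to the minimizers the two preceding lemmas suffice, because uniform convergence
makes perturbed feasible points nearly feasible. The upper bound needs the hypothesis \<open>strict\<close>: a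
strictly feasible point of value close to \<open>v\<close> stays feasible under small perturbations,
whereas an optimal point with an active constraint may be cut off. Continuity of the perturbed
constraints ensures that their problems have minimizers at all; without minimizers the deviation would be
\<open>-\<infinity>\<close>.\<close>

theorem perturbed_constraint_stability:
  fixes f g :: "'z::real_normed_vector \<Rightarrow> real" and gn :: "'i \<Rightarrow> 'z \<Rightarrow> real"
  assumes Z: "compact Z" and f: "continuous_on Z f" and g: "continuous_on Z g"
    and gn: "\<forall>\<^sub>F i in F. continuous_on Z (gn i)"
    and unif: "\<And>\<eta>. \<eta> > 0 \<Longrightarrow> \<forall>\<^sub>F i in F. \<forall>z\<in>Z. \<bar>gn i z - g z\<bar> \<le> \<eta>"
    and strict: "\<And>\<delta>. \<delta> > 0 \<Longrightarrow> \<exists>z\<in>Z. g z > c \<and> f z \<le> v + \<delta>"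
    and lower: "\<And>z. z \<in> Z \<Longrightarrow> g z \<ge> c \<Longrightarrow> v \<le> f z"
  shows "((\<lambda>i. INF z\<in>{z\<in>Z. gn i z \<ge> c}. ereal (f z)) \<longlongrightarrow> ereal v) F"
    and "((\<lambda>i. deviation (minimizers f {z\<in>Z. gn i z \<ge> c}) (minimizers f {z\<in>Z. g z \<ge> c}))
            \<longlongrightarrow> 0) F"
proof -
  let ?D = "minimizers f {z\<in>Z. g z \<ge> c}"
  let ?Dn = "\<lambda>i. minimizers f {z\<in>Z. gn i z \<ge> c}"
  let ?val = "\<lambda>i. INF z\<in>{z\<in>Z. gn i z \<ge> c}. ereal (f z)"
  have nonempty: "\<forall>\<^sub>F i in F. \<exists>z. z \<in> ?Dn i \<and> ?val i = ereal (f z)"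
  proof -
    obtain z0 where z0: "z0 \<in> Z" "g z0 > c" using strict[of 1] by auto
    have "\<forall>\<^sub>F i in F. \<forall>z\<in>Z. \<bar>gn i z - g z\<bar> \<le> g z0 - c" using unif z0 by simp
    then show ?thesis using gn
    proof eventually_elim
      case (elim i)
      have "z0 \<in> {z\<in>Z. gn i z \<ge> c}" using elim(1) z0 by force
      moreover have "continuous_on {z\<in>Z. gn i z \<ge> c} f" using f by (rule continuous_on_subset) auto
      ultimately obtain z where z: "z \<in> {z\<in>Z. gn i z \<ge> c}" "\<forall>y\<in>{z\<in>Z. gn i z \<ge> c}. f z \<le> f y"
        using continuous_attains_inf[OF compact_superlevel[OF Z elim(2)], of c f] by blast
      have "?val i = ereal (f z)"
        by (intro antisym INF_lower INF_greatest) (use z in auto)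
      then show ?case using z unfolding minimizers_iff by blast
    qed
  qed
  have near: "\<forall>\<^sub>F i in F. \<forall>z\<in>?Dn i. z \<in> Z \<and> g z \<ge> c - e \<and> f z \<le> v + e" if e_pos: "e > 0" for e
  proof -
    obtain z0 where z0: "z0 \<in> Z" "g z0 > c" "f z0 \<le> v + e" using strict[OF e_pos] by auto
    have "\<forall>\<^sub>F i in F. \<forall>z\<in>Z. \<bar>gn i z - g z\<bar> \<le> min e (g z0 - c)" by (intro unif) (use z0 e_pos in simp)
    then show ?thesis
    proof eventually_elim
      case (elim i)
      have z0_in: "z0 \<in> {z\<in>Z. gn i z \<ge> c}" using elim z0 by force
      show ?case
      proof (intro ballI)
        fix z assume "z \<in> ?Dn i"
        then have z: "z \<in> Z" "gn i z \<ge> c" "f z \<le> f z0" using z0_in unfolding minimizers_iff by auto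
        moreover have "\<bar>gn i z - g z\<bar> \<le> e" using elim z(1) by auto
        ultimately show "z \<in> Z \<and> g z \<ge> c - e \<and> f z \<le> v + e" using z0(3) by auto
      qed
    qed
  qed
  have val: "\<forall>\<^sub>F i in F. ereal (v - \<delta>) < ?val i \<and> ?val i < ereal (v + \<delta>)" if delta: "\<delta> > 0" for \<delta>
  proof -
    obtain e where e: "e > 0" "\<And>z. z \<in> Z \<Longrightarrow> g z \<ge> c - e \<Longrightarrow> v - \<delta> < f z"
      using near_feasible_not_much_better[OF Z f g lower delta] by blast
    have "min e (\<delta> / 2) > 0" using e(1) delta by simp
    from near[OF this] nonempty show ?thesis
    proof eventually_elim
      case (elim i)
      then obtain z where z: "z \<in> ?Dn i" "?val i = ereal (f z)" by blast
      have "z \<in> Z" "g z \<ge> c - min e (\<delta> / 2)" "f z \<le> v + min e (\<delta> / 2)" using elim(1) z(1) by blast+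
      then have "v - \<delta> < f z" "f z < v + \<delta>" using e(2)[of z] delta by auto
      then show ?case using z(2) by simp
    qed
  qed
  show "(?val \<longlongrightarrow> ereal v) F"
  proof (rule order_tendstoI)
    fix a assume "a < ereal v"
    then obtain r where r: "a < ereal r" "r < v" using ereal_dense2 by fastforce
    have "\<forall>\<^sub>F i in F. ereal (v - (v - r)) < ?val i \<and> ?val i < ereal (v + (v - r))"
      using r by (intro val) simp
    then show "\<forall>\<^sub>F i in F. a < ?val i"
      by eventually_elim (use r in \<open>auto intro: less_trans\<close>)
  next
    fix a assume "ereal v < a"
    then obtain r where r: "ereal r < a" "v < r" using ereal_dense2 by fastforce
    have "\<forall>\<^sub>F i in F. ereal (v - (r - v)) < ?val i \<and> ?val i < ereal (v + (r - v))"
      using r by (intro val) simp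
    then show "\<forall>\<^sub>F i in F. ?val i < a"
      by eventually_elim (use r in \<open>auto intro: less_trans\<close>)
  qed
  have dev: "\<forall>\<^sub>F i in F. deviation (?Dn i) ?D \<le> ereal \<tau>" if tau: "\<tau> > 0" for \<tau>
  proof -
    obtain e where e: "e > 0" "\<And>z. z \<in> Z \<Longrightarrow> g z \<ge> c - e \<Longrightarrow> f z \<le> v + e \<Longrightarrow>
       \<exists>z'\<in>?D. norm (z - z') < \<tau>"
      using near_optimal_near_minimizers[OF Z f g lower tau] by blast
    from near[OF e(1)] show ?thesis
    proof eventually_elim
      case (elim i)
      show ?case unfolding deviation_def
      proof (rule SUP_least)
        fix z assume "z \<in> ?Dn i"
        then obtain z' where "z' \<in> ?D" "norm (z - z') < \<tau>" using elim e(2) by blast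
        then show "(INF z'\<in>?D. ereal (norm (z - z'))) \<le> ereal \<tau>"
          by (intro INF_lower2[of z']) auto
      qed
    qed
  qed
  have dev0: "\<forall>\<^sub>F i in F. 0 \<le> deviation (?Dn i) ?D"
    using nonempty
  proof eventually_elim
    case (elim i)
    then obtain z where "z \<in> ?Dn i" by blast
    then show ?case unfolding deviation_def
      by (intro SUP_upper2[of z]) (auto intro!: INF_greatest)
  qed
  show "((\<lambda>i. deviation (?Dn i) ?D) \<longlongrightarrow> 0) F"
  proof (rule order_tendstoI)
    fix a :: ereal assume a: "a < 0"
    show "\<forall>\<^sub>F i in F. a < deviation (?Dn i) ?D"
      using dev0 by eventually_elim (use a in \<open>auto intro: less_le_trans\<close>)
  next
    fix a :: ereal assume "0 < a"
    then obtain r where r: "0 < r" "ereal r < a" by (metis ereal_dense2 zero_ereal_def ereal_less(2))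
    show "\<forall>\<^sub>F i in F. deviation (?Dn i) ?D < a"
      using dev[OF r(1)] by eventually_elim (use r in \<open>auto intro: le_less_trans\<close>)
  qed
qed

section \<open>Reduction of probability measures to two points\<close>

definition two_point :: "real \<Rightarrow> 'x \<Rightarrow> 'x \<Rightarrow> 'x two_point" where
  "two_point t x y = (\<chi> i. if i = 1 then t else 1 - t, \<chi> i. if i = 1 then x else y)"

lemma two_point_mean_two_point: "two_point_mean f (two_point t x y) = t * f x + (1 - t) * f y"
  by (simp add: two_point_mean_def two_point_def sum_2 mult.commute)

lemma two_points_eq: "two_points X = (\<lambda>(t, x, y). two_point t x y) ` ({0..1} \<times> X \<times> X)"
proof (intro subset_antisym subsetI)
  fix z :: "'a two_point" assume z: "z \<in> two_points X"
  obtain w x where zwx: "z = (w, x)" by (cases z)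
  have "z = two_point (w $ 1) (x $ 1) (x $ 2)"
    using z unfolding zwx two_point_def two_points_def two_point_weights_def
    by (auto simp: vec_eq_iff forall_2)
  moreover have "w $ 1 \<in> {0..1}" "x $ 1 \<in> X" "x $ 2 \<in> X"
    using z unfolding zwx two_points_def two_point_weights_def by auto
  ultimately show "z \<in> (\<lambda>(t, x, y). two_point t x y) ` ({0..1} \<times> X \<times> X)" by force
qed (auto simp: two_point_def two_points_def two_point_weights_def forall_2)

lemma two_point_in_two_points:
  "t \<in> {0..1} \<Longrightarrow> x \<in> X \<Longrightarrow> y \<in> X \<Longrightarrow> two_point t x y \<in> two_points X"
  by (auto simp: two_point_def two_points_def two_point_weights_def)

lemma compact_two_points:
  fixes X :: "'x::real_normed_vector set"
  assumes "compact X"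
  shows "compact (two_points X)"
  unfolding two_points_eq two_point_def case_prod_beta
proof (rule compact_continuous_image)
  show "continuous_on ({0..1} \<times> X \<times> X) (\<lambda>z :: real \<times> 'x \<times> 'x. (\<chi> i. if i = (1::2) then fst z else 1 - fst z,
      \<chi> i. if i = (1::2) then fst (snd z) else snd (snd z)))"
  proof (intro continuous_on_Pair continuous_on_vec_lambda)
    fix i :: 2
    show "continuous_on ({0..1} \<times> X \<times> X) (\<lambda>z :: real \<times> 'x \<times> 'x. if i = 1 then fst z else 1 - fst z)"
      by (cases "i = 1") (simp_all add: continuous_on_fst continuous_on_snd continuous_on_diff continuous_on_id)
    show "continuous_on ({0..1} \<times> X \<times> X) (\<lambda>z :: real \<times> 'x \<times> 'x. if i = 1 then fst (snd z) else snd (snd z))"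
      by (cases "i = 1") (simp_all add: continuous_on_fst continuous_on_snd continuous_on_diff continuous_on_id)
  qed
qed (intro compact_Times assms compact_Icc)

lemma continuous_on_two_point_mean:
  fixes X :: "'x::real_normed_vector set"
  assumes "continuous_on X f"
  shows "continuous_on (two_points X) (two_point_mean f)"
  unfolding two_point_mean_def
  by (intro continuous_intros continuous_on_compose2[OF assms])
     (auto simp: two_points_def)

lemma two_point_mean_diff_le:
  assumes "z \<in> two_points X" "\<And>x. x \<in> X \<Longrightarrow> \<bar>f x - g x\<bar> \<le> \<eta>"
  shows "\<bar>two_point_mean f z - two_point_mean g z\<bar> \<le> \<eta>"
proof -
  obtain t x y where z: "z = two_point t x y" "t \<in> {0..1}" "x \<in> X" "y \<in> X"
    using assms(1) unfolding two_points_eq by auto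
  have "\<bar>two_point_mean f z - two_point_mean g z\<bar> = \<bar>t * (f x - g x) + (1 - t) * (f y - g y)\<bar>"
    unfolding z(1) two_point_mean_two_point by (simp add: algebra_simps)
  also have "\<dots> \<le> \<bar>t * (f x - g x)\<bar> + \<bar>(1 - t) * (f y - g y)\<bar>" by (rule abs_triangle_ineq)
  also have "\<dots> = t * \<bar>f x - g x\<bar> + (1 - t) * \<bar>f y - g y\<bar>" using z(2) by (simp add: abs_mult)
  also have "\<dots> \<le> t * \<eta> + (1 - t) * \<eta>"
    by (intro add_mono mult_left_mono) (use z assms(2) in auto)
  finally show ?thesis by (simp add: algebra_simps)
qed

text \<open>The ratio test of the simplex method: moving along \<open>e\<close>, the first weight to vanish is one
with the least ratio \<open>w i / - e i\<close> among the decreasing weights.\<close>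

lemma weights_move_to_boundary:
  fixes w e :: "'i \<Rightarrow> real"
  assumes "finite I" "\<And>i. i \<in> I \<Longrightarrow> w i \<ge> 0" "\<exists>i\<in>I. e i < 0"
  obtains t k where "t \<ge> 0" "k \<in> I" "w k + t * e k = 0" "\<And>i. i \<in> I \<Longrightarrow> w i + t * e i \<ge> 0"
proof -
  let ?N = "{i\<in>I. e i < 0}"
  have "finite ?N" "?N \<noteq> {}" using assms by auto
  then have "Min ((\<lambda>i. w i / - e i) ` ?N) \<in> (\<lambda>i. w i / - e i) ` ?N" by (intro Min_in) auto
  then obtain k where k: "k \<in> ?N" "w k / - e k = Min ((\<lambda>i. w i / - e i) ` ?N)" by auto
  define t where "t = w k / - e k"
  have t0: "t \<ge> 0" unfolding t_def using k(1) assms(2) by (auto intro!: divide_nonneg_neg)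
  show ?thesis
  proof (rule that[OF t0, of k])
    show "k \<in> I" "w k + t * e k = 0" using k(1) unfolding t_def by auto
    fix i assume i: "i \<in> I"
    show "w i + t * e i \<ge> 0"
    proof (cases "e i < 0")
      case True
      then have "t \<le> w i / - e i" unfolding t_def k(2) using i \<open>finite ?N\<close> by (intro Min_le) auto
      then have "t * - e i \<le> w i" using True by (simp only: pos_le_divide_eq[of "- e i"] neg_0_less_iff_less)
      then show ?thesis by simp
    qed (use i assms t0 in auto)
  qed
qed

text \<open>Weights on three points have a degree of freedom left once their total and the mean of the second
coordinate are fixed. The orientation is chosen so that the mean of the first coordinate does not
increase.\<close>

lemma balanced_direction:
  fixes S :: "(real \<times> real) set"
  assumes "finite S" "card S \<ge> 3"
  obtains e where "(\<Sum>q\<in>S. e q) = 0" "(\<Sum>q\<in>S. e q * snd q) = 0"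
    "(\<Sum>q\<in>S. e q * fst q) \<le> 0" "\<exists>q\<in>S. e q < 0"
proof -
  obtain T where T: "T \<subseteq> S" "card T = 3" using obtain_subset_with_card_n[OF assms(2)] by metis
  then obtain x y z where xyz: "T = {x, y, z}" "x \<noteq> y" "x \<noteq> z" "y \<noteq> z" unfolding card_3_iff by auto
  then have mem: "x \<in> S" "y \<in> S" "z \<in> S" using T(1) by auto
  have "\<exists>a b c. (a, b, c) \<noteq> (0, 0, 0) \<and> a + b + c = 0 \<and> a * snd x + b * snd y + c * snd z = 0"
  proof (cases "snd x = snd y")
    case True
    then show ?thesis by (intro exI[of _ 1] exI[of _ "-1"] exI[of _ 0]) auto
  next
    case False
    \<comment> \<open>The witness is, up to sign, the cross product of \<open>(1, 1, 1)\<close> and \<open>(snd x, snd y, snd z)\<close>,\<close>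
    \<comment> \<open>which is orthogonal to both.\<close>
    then show ?thesis
      by (intro exI[of _ "snd y - snd z"] exI[of _ "snd z - snd x"] exI[of _ "snd x - snd y"])
         (auto simp: algebra_simps)
  qed
  then obtain a b c where abc: "(a, b, c) \<noteq> (0, 0, 0)" "a + b + c = 0"
    "a * snd x + b * snd y + c * snd z = 0" by blast
  define d where "d q = (if q = x then a else 0) + (if q = y then b else 0) + (if q = z then c else 0)" for q
  have sum_d: "(\<Sum>q\<in>S. d q * f q) = a * f x + b * f y + c * f z" for f
    using assms(1) mem by (simp add: d_def distrib_right sum.distrib if_distrib[of "\<lambda>s. s * _"] cong: if_cong)
  have d0: "(\<Sum>q\<in>S. d q) = 0" using sum_d[of "\<lambda>_. 1"] abc(2) by simp
  have dne: "\<exists>q\<in>S. d q \<noteq> 0"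
  proof (rule ccontr)
    assume "\<not> ?thesis"
    then have "d x = 0" "d y = 0" "d z = 0" using mem by auto
    then show False using abc(1) xyz by (auto simp: d_def)
  qed
  define s :: real where "s = (if (\<Sum>q\<in>S. d q * fst q) \<le> 0 then 1 else -1)"
  define e where "e q = s * d q" for q
  have e: "(\<Sum>q\<in>S. e q * f q) = s * (\<Sum>q\<in>S. d q * f q)" for f
    unfolding e_def by (simp add: sum_distrib_left mult.assoc)
  show ?thesis
  proof (rule that[of e])
    show e0: "(\<Sum>q\<in>S. e q) = 0" using e[of "\<lambda>_. 1"] d0 by simp
    show "(\<Sum>q\<in>S. e q * snd q) = 0" unfolding e sum_d abc(3) by simp
    show "(\<Sum>q\<in>S. e q * fst q) \<le> 0" unfolding e s_def by simp
    show "\<exists>q\<in>S. e q < 0"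
    proof (rule ccontr)
      assume "\<not> ?thesis"
      then have "\<forall>q\<in>S. e q = 0" using e0 assms(1) by (subst (asm) sum_nonneg_eq_0_iff) auto
      then show False using dne unfolding e_def s_def by (auto split: if_splits)
    qed
  qed
qed

text \<open>The linear program of minimizing the mean of the first coordinate for a given mean of the second one
has two equality constraints, so two points carry a basic optimal solution. As long as the
support has at least three points, a balanced direction removes one of them without increasing the objective.\<close>

lemma finite_mixture_dominated_by_two:
  fixes S :: "(real \<times> real) set" and w :: "real \<times> real \<Rightarrow> real"
  assumes "finite S" "\<And>q. q \<in> S \<Longrightarrow> w q \<ge> 0" "(\<Sum>q\<in>S. w q) = 1"
  shows "\<exists>a\<in>S. \<exists>b\<in>S. \<exists>t\<in>{0..1}. t * fst a + (1 - t) * fst b \<le> (\<Sum>q\<in>S. w q * fst q) \<and>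
           t * snd a + (1 - t) * snd b = (\<Sum>q\<in>S. w q * snd q)"
  using assms
proof (induction "card S" arbitrary: S w rule: less_induct)
  case less
  have "S \<noteq> {}" using less.prems(3) by auto
  then have "card S \<noteq> 0" using less.prems(1) by simp
  then consider "card S = 1" | "card S = 2" | "card S \<ge> 3" by linarith
  then show ?case
  proof cases
    case 1
    then obtain a where a: "S = {a}" by (auto simp: card_1_singleton_iff)
    show ?thesis using less.prems(3) unfolding a by (auto intro!: bexI[of _ 1])
  next
    case 2
    then obtain a b where ab: "S = {a, b}" "a \<noteq> b" by (auto simp: card_2_iff)
    then have "w b = 1 - w a" "w a \<in> {0..1}" using less.prems(2)[of a] less.prems(2)[of b] less.prems(3) by auto
    moreover have "a \<in> S" "b \<in> S" using ab(1) by auto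
    ultimately show ?thesis
      by (rule_tac bexI[of _ a], rule_tac bexI[of _ b], rule_tac bexI[of _ "w a"]) (simp_all add: ab)
  next
    case 3
    obtain e where e: "(\<Sum>q\<in>S. e q) = 0" "(\<Sum>q\<in>S. e q * snd q) = 0"
      "(\<Sum>q\<in>S. e q * fst q) \<le> 0" "\<exists>q\<in>S. e q < 0"
      by (rule balanced_direction[OF less.prems(1) 3])
    obtain t k where tk: "t \<ge> 0" "k \<in> S" "w k + t * e k = 0" "\<And>i. i \<in> S \<Longrightarrow> w i + t * e i \<ge> 0"
      by (rule weights_move_to_boundary[of S w e]) (use less.prems e in auto)
    define w' where "w' q = w q + t * e q" for q
    have sum': "(\<Sum>q\<in>S - {k}. w' q * f q) = (\<Sum>q\<in>S. w q * f q) + t * (\<Sum>q\<in>S. e q * f q)" for f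
    proof -
      have "(\<Sum>q\<in>S - {k}. w' q * f q) = (\<Sum>q\<in>S. w' q * f q)"
        by (rule sum.mono_neutral_left) (use less.prems(1) tk(3) in \<open>auto simp: w'_def\<close>)
      then show ?thesis unfolding w'_def by (simp add: algebra_simps sum.distrib sum_distrib_left)
    qed
    have "\<exists>a\<in>S - {k}. \<exists>b\<in>S - {k}. \<exists>r\<in>{0..1}.
        r * fst a + (1 - r) * fst b \<le> (\<Sum>q\<in>S - {k}. w' q * fst q) \<and>
        r * snd a + (1 - r) * snd b = (\<Sum>q\<in>S - {k}. w' q * snd q)"
    proof (rule less.hyps)
      show "card (S - {k}) < card S" using tk(2) less.prems(1) by (intro psubset_card_mono) auto
      show "finite (S - {k})" using less.prems(1) by simp
      show "w' q \<ge> 0" if "q \<in> S - {k}" for q using tk(4) that unfolding w'_def by auto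
      show "(\<Sum>q\<in>S - {k}. w' q) = 1" using sum'[of "\<lambda>_. 1"] less.prems(3) e(1) by simp
    qed
    then obtain a b r where abr: "a \<in> S" "b \<in> S" "r \<in> {0..1}"
      "r * fst a + (1 - r) * fst b \<le> (\<Sum>q\<in>S - {k}. w' q * fst q)"
      "r * snd a + (1 - r) * snd b = (\<Sum>q\<in>S - {k}. w' q * snd q)"
      by (elim bexE conjE DiffE)
    have "t * (\<Sum>q\<in>S. e q * fst q) \<le> 0" using tk(1) e(3) by (rule mult_nonneg_nonpos)
    then have "r * fst a + (1 - r) * fst b \<le> (\<Sum>q\<in>S. w q * fst q)" using abr(4) unfolding sum' by simp
    moreover have "r * snd a + (1 - r) * snd b = (\<Sum>q\<in>S. w q * snd q)" using abr(5) e(2) unfolding sum' by simp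
    ultimately have "r * fst a + (1 - r) * fst b \<le> (\<Sum>q\<in>S. w q * fst q) \<and>
        r * snd a + (1 - r) * snd b = (\<Sum>q\<in>S. w q * snd q)" by (rule conjI)
    note domination = this
    show ?thesis
      by (rule bexI[OF _ abr(1)], rule bexI[OF _ abr(2)], rule bexI[OF _ abr(3)], rule domination)
  qed
qed

lemma prob_measures_on_integrable:
  fixes f :: "'x::real_normed_vector \<Rightarrow> real"
  assumes "compact X" "continuous_on X f" "\<mu> \<in> prob_measures_on X"
  shows "integrable \<mu> f"
proof -
  interpret prob_space \<mu> using assms(3) unfolding prob_measures_on_def by auto
  have sets: "sets \<mu> = sets (restrict_space borel X)" using assms(3) unfolding prob_measures_on_def by auto
  have space: "space \<mu> = X" using sets_eq_imp_space_eq[OF sets] by (simp add: space_restrict_space)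
  obtain B where B: "\<And>x. x \<in> X \<Longrightarrow> norm (f x) \<le> B"
    using compact_imp_bounded[OF compact_continuous_image[OF assms(2,1)]] by (auto simp: bounded_iff)
  have "f \<in> borel_measurable \<mu>"
    using borel_measurable_continuous_on_restrict[OF assms(2)] measurable_cong_sets[OF sets refl] by blast
  then show ?thesis by (intro integrable_const_bound[of _ B] AE_I2) (use B in \<open>auto simp: space\<close>)
qed

text \<open>A point outside the closed convex hull could be separated from it by a hyperplane, and integrating the
separating inequality would contradict that the point is a mean.\<close>

lemma barycenter_in_convex_hull:
  fixes f :: "'x::real_normed_vector \<Rightarrow> real" and g :: "'x \<Rightarrow> real"
  assumes X: "compact X" and f: "continuous_on X f" and g: "continuous_on X g"
    and mu: "\<mu> \<in> prob_measures_on X"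
  shows "((LINT x|\<mu>. f x), (LINT x|\<mu>. g x)) \<in> convex hull ((\<lambda>x. (f x, g x)) ` X)"
proof (rule ccontr)
  let ?K = "(\<lambda>x. (f x, g x)) ` X"
  let ?c = "((LINT x|\<mu>. f x), (LINT x|\<mu>. g x))"
  assume out: "?c \<notin> convex hull ?K"
  interpret prob_space \<mu> using mu unfolding prob_measures_on_def by auto
  have sets: "sets \<mu> = sets (restrict_space borel X)" using mu unfolding prob_measures_on_def by auto
  have space: "space \<mu> = X" using sets_eq_imp_space_eq[OF sets] by (simp add: space_restrict_space)
  note [simp] = prob_measures_on_integrable[OF X f mu] prob_measures_on_integrable[OF X g mu]
  have "compact ?K" by (intro compact_continuous_image X continuous_intros f g)
  then have "closed (convex hull ?K)" by (intro compact_imp_closed compact_convex_hull)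
  then obtain a b where ab: "inner a ?c < b" "\<And>q. q \<in> convex hull ?K \<Longrightarrow> inner a q > b"
    using separating_hyperplane_closed_point[OF convex_convex_hull _ out] by blast
  have "b = (LINT x|\<mu>. b)" by (simp add: prob_space)
  also have "\<dots> \<le> (LINT x|\<mu>. fst a * f x + snd a * g x)"
  proof (rule integral_mono)
    fix x assume "x \<in> space \<mu>"
    then have "(f x, g x) \<in> convex hull ?K" unfolding space by (intro hull_inc) auto
    from ab(2)[OF this] show "b \<le> fst a * f x + snd a * g x" by (simp add: inner_prod_def)
  qed auto
  also have "\<dots> = inner a ?c" by (simp add: inner_prod_def)
  finally show False using ab(1) by simp
qed

text \<open>The map \<open>x \<mapsto> (f x, g x)\<close> takes values in the plane, and the barycenter of its image measure is a finite
mixture of its points, which the reduction to two points then dominates.\<close>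

theorem measure_dominated_by_two_point:
  fixes f :: "'x::real_normed_vector \<Rightarrow> real" and g :: "'x \<Rightarrow> real"
  assumes X: "compact X" and f: "continuous_on X f" and g: "continuous_on X g"
    and mu: "\<mu> \<in> prob_measures_on X"
  shows "\<exists>z\<in>two_points X. two_point_mean f z \<le> (LINT x|\<mu>. f x) \<and> two_point_mean g z = (LINT x|\<mu>. g x)"
proof -
  obtain S w where S: "finite S" "S \<subseteq> (\<lambda>x. (f x, g x)) ` X" "\<And>q. q \<in> S \<Longrightarrow> w q \<ge> 0" "(\<Sum>q\<in>S. w q) = 1"
    "(\<Sum>q\<in>S. w q *\<^sub>R q) = ((LINT x|\<mu>. f x), (LINT x|\<mu>. g x))"
    using barycenter_in_convex_hull[OF assms] unfolding convex_hull_explicit by auto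
  have bary: "(\<Sum>q\<in>S. w q * fst q) = (LINT x|\<mu>. f x)" "(\<Sum>q\<in>S. w q * snd q) = (LINT x|\<mu>. g x)"
    using arg_cong[OF S(5), of fst] arg_cong[OF S(5), of snd] by (simp_all add: fst_sum snd_sum)
  obtain a b t where abt: "a \<in> S" "b \<in> S" "t \<in> {0..1}"
    "t * fst a + (1 - t) * fst b \<le> (LINT x|\<mu>. f x)" "t * snd a + (1 - t) * snd b = (LINT x|\<mu>. g x)"
    using finite_mixture_dominated_by_two[OF S(1,3,4)] unfolding bary by blast
  obtain x y where xy: "x \<in> X" "y \<in> X" "a = (f x, g x)" "b = (f y, g y)" using abt(1,2) S(2) by blast
  show ?thesis
    by (rule bexI[OF _ two_point_in_two_points[OF abt(3) xy(1,2)]])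
       (use abt(4,5) xy(3,4) in \<open>simp add: two_point_mean_two_point\<close>)
qed

lemma two_point_as_measure:
  fixes X :: "'x::real_normed_vector set"
  assumes "z \<in> two_points X"
  obtains \<mu> where "\<mu> \<in> prob_measures_on X"
    "\<And>f :: 'x \<Rightarrow> real. continuous_on X f \<Longrightarrow> (LINT x|\<mu>. f x) = two_point_mean f z"
proof -
  obtain t x y where z: "z = two_point t x y" "0 \<le> t" "t \<le> 1" "x \<in> X" "y \<in> X"
    using assms unfolding two_points_eq by auto
  define u where "u b = (if b then x else y)" for b
  define \<mu> where "\<mu> = distr (measure_pmf (bernoulli_pmf t)) (restrict_space borel X) u"
  have u: "u \<in> measure_pmf (bernoulli_pmf t) \<rightarrow>\<^sub>M restrict_space borel X"
    using z by (intro measurable_restrict_space2) (auto simp: u_def)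
  show ?thesis
  proof (rule that[of \<mu>])
    show "\<mu> \<in> prob_measures_on X"
      unfolding prob_measures_on_def \<mu>_def using measure_pmf.prob_space_distr[OF u] by simp
    fix f :: "'x \<Rightarrow> real" assume "continuous_on X f"
    then show "(LINT x|\<mu>. f x) = two_point_mean f z"
      unfolding \<mu>_def z(1) two_point_mean_two_point
      by (subst integral_distr[OF u borel_measurable_continuous_on_restrict])
         (use z in \<open>auto simp: u_def mult.commute\<close>)
  qed
qed

text \<open>Randomizing over two points is as good as randomizing with an arbitrary measure: every measure is
dominated by a two-point element, and every two-point element is a measure.\<close>

theorem opt_measure_val_eq_two_point_val:
  fixes X :: "'x::real_normed_vector set"
  assumes X: "compact X" and J: "continuous_on X J" and P: "continuous_on X P"
  shows "opt_measure_val X J P \<alpha> = two_point_val X J P \<alpha>"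
proof (rule antisym)
  show "opt_measure_val X J P \<alpha> \<le> two_point_val X J P \<alpha>"
    unfolding two_point_val_def
  proof (rule INF_greatest)
    fix z assume z: "z \<in> two_point_feasible X P \<alpha>"
    then obtain \<mu> where mu: "\<mu> \<in> prob_measures_on X"
      "\<And>f :: 'x \<Rightarrow> real. continuous_on X f \<Longrightarrow> (LINT x|\<mu>. f x) = two_point_mean f z"
      using two_point_as_measure[of z X] unfolding two_point_feasible_def by blast
    then show "opt_measure_val X J P \<alpha> \<le> ereal (two_point_mean J z)"
      unfolding opt_measure_val_def
      by (intro INF_lower2[of \<mu>]) (use z J P in \<open>auto simp: feasible_measures_def two_point_feasible_def\<close>)
  qed
  show "two_point_val X J P \<alpha> \<le> opt_measure_val X J P \<alpha>"
    unfolding opt_measure_val_def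
  proof (rule INF_greatest)
    fix \<mu> assume mu: "\<mu> \<in> feasible_measures X P \<alpha>"
    then obtain z where "z \<in> two_points X" "two_point_mean J z \<le> (LINT x|\<mu>. J x)" 
      "two_point_mean P z = (LINT x|\<mu>. P x)"
      using measure_dominated_by_two_point[OF X J P] unfolding feasible_measures_def by blast
    then show "two_point_val X J P \<alpha> \<le> ereal (LINT x|\<mu>. J x)"
      unfolding two_point_val_def
      by (intro INF_lower2[of z]) (use mu in \<open>auto simp: feasible_measures_def two_point_feasible_def\<close>)
  qed
qed

section \<open>Uniform strong law for smoothed indicators\<close>

text \<open>The strong law of large numbers for indicators. Hoeffding's inequality bounds the probability of an error
of at least \<open>e\<close> after \<open>n\<close> trials by a geometric sequence in \<open>n\<close>, which is summable, so the first
Borel-Cantelli lemma allows only finitely many such errors.\<close>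

lemma (in prob_space) AE_frequency_tendsto:
  assumes indep: "indep_vars (\<lambda>_. N) Y UNIV" and A: "A \<in> sets N"
    and q: "\<And>j. prob (Y j -` A \<inter> space M) = q"
  shows "AE \<omega> in M. (\<lambda>n. (\<Sum>j<n. indicator A (Y j \<omega>)) / real n) \<longlonglongrightarrow> q"
proof -
  define I where "I j \<omega> = (indicator A (Y j \<omega>) :: real)" for j \<omega>
  have Y[measurable]: "Y j \<in> M \<rightarrow>\<^sub>M N" for j using indep unfolding indep_vars_def by auto
  note A[measurable]
  have I[measurable]: "I j \<in> borel_measurable M" for j unfolding I_def by measurable
  have exp_I: "expectation (I j) = q" for j
  proof -
    have "expectation (I j) = expectation (indicator (Y j -` A \<inter> space M))"
      by (rule Bochner_Integration.integral_cong) (auto simp: I_def split: split_indicator)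
    also have "\<dots> = q" using q[of j] by simp
    finally show ?thesis .
  qed
  have indep_I: "indep_vars (\<lambda>_. borel) I UNIV"
    unfolding I_def by (rule indep_vars_compose2[OF indep]) simp
  have close: "AE \<omega> in M. \<forall>\<^sub>F n in sequentially. \<bar>(\<Sum>j<n. I j \<omega>) / real n - q\<bar> < e" if e: "e > 0" for e
  proof -
    define B where "B n = {\<omega>\<in>space M. \<bar>(\<Sum>j<n. I j \<omega>) - real n * q\<bar> \<ge> real n * e}" for n
    have B[measurable]: "B n \<in> events" for n unfolding B_def by measurable
    have bound: "prob (B n) \<le> 2 * exp (- 2 * e\<^sup>2) ^ n" for n
    proof (cases "n = 0")
      case True
      have "prob (B n) \<le> 2" using prob_le_1[of "B n"] by linarith
      then show ?thesis using True by simp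
    next
      case False
      interpret H: Hoeffding_ineq M "{..<n}" I "\<lambda>_. 0" "\<lambda>_. 1" "real n * q"
      proof unfold_locales
        show "indep_vars (\<lambda>_. borel) I {..<n}" by (rule indep_vars_subset[OF indep_I]) auto
        show "real n * q \<equiv> \<Sum>i<n. expectation (I i)" by (simp add: exp_I)
      qed (auto simp: I_def split: split_indicator)
      have "prob (B n) \<le> 2 * exp (- 2 * (real n * e)\<^sup>2 / (\<Sum>i<n. (1 - 0)\<^sup>2))"
        unfolding B_def by (rule H.Hoeffding_ineq_abs_ge) (use False e in auto)
      also have "- 2 * (real n * e)\<^sup>2 / (\<Sum>i<n. (1 - 0)\<^sup>2) = real n * (- 2 * e\<^sup>2)"
        using False by (simp add: power2_eq_square field_simps)
      finally show ?thesis by (simp only: exp_of_nat_mult)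
    qed
    have "summable (\<lambda>n. 2 * exp (- 2 * e\<^sup>2) ^ n)"
      by (intro summable_mult summable_geometric) (use e in simp)
    then have "summable (\<lambda>n. prob (B n))"
      by (rule summable_comparison_test') (use bound in simp)
    then have "AE \<omega> in M. \<forall>\<^sub>F n in sequentially. \<omega> \<in> space M - B n"
      by (intro borel_cantelli_AE1) (auto simp: emeasure_eq_measure)
    then show ?thesis
    proof eventually_elim
      case (elim \<omega>)
      from elim eventually_gt_at_top[of 0] show ?case
      proof eventually_elim
        case (elim n)
        then have "\<bar>(\<Sum>j<n. I j \<omega>) - real n * q\<bar> < real n * e" unfolding B_def by auto
        moreover have "(\<Sum>j<n. I j \<omega>) / real n - q = ((\<Sum>j<n. I j \<omega>) - real n * q) / real n"
          using elim(2) by (simp add: field_simps)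
        ultimately show ?case using elim(2) by (simp add: abs_divide pos_divide_less_eq mult.commute)
      qed
    qed
  qed
  have "AE \<omega> in M. \<forall>k. \<forall>\<^sub>F n in sequentially. \<bar>(\<Sum>j<n. I j \<omega>) / real n - q\<bar> < inverse (real (Suc k))"
    unfolding AE_all_countable by (intro allI close) simp
  then show ?thesis
  proof eventually_elim
    case (elim \<omega>)
    show ?case
    proof (rule tendstoI)
      fix e :: real assume "e > 0"
      then obtain k where "inverse (real (Suc k)) < e" using reals_Archimedean by blast
      then show "\<forall>\<^sub>F n in sequentially. dist ((\<Sum>j<n. indicator A (Y j \<omega>)) / real n) q < e"
        using elim[THEN spec, of k] by (auto elim!: eventually_mono simp: dist_real_def I_def)
    qed
  qed
qed

text \<open>A chance constraint \<open>g x t \<le> 0\<close> on the decision \<open>x\<close>, where \<open>L\<close> is the law of the random parameter \<open>t\<close>. That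
each boundary \<open>g x t = 0\<close> is a null event is what makes the probability of satisfaction continuous in \<open>x\<close>, although
the indicator under the integral jumps there.\<close>

locale null_level_family = prob_space L for L :: "'s::euclidean_space measure" +
  fixes X :: "'x::metric_space set" and \<Xi> :: "'s set" and g :: "'x \<Rightarrow> 's \<Rightarrow> real"
  assumes sets_L: "sets L = sets borel"
    and compact_X: "compact X" and closed_Xi: "closed \<Xi>"
    and cont: "continuous_on (X \<times> \<Xi>) (\<lambda>(x, t). g x t)"
    and null: "\<And>x. x \<in> X \<Longrightarrow> prob {t\<in>\<Xi>. g x t = 0} = 0"
begin

definition sat :: "'x \<Rightarrow> 's set" where
  "sat x = {t\<in>\<Xi>. g x t \<le> 0}"

lemma cont_t: "x \<in> X \<Longrightarrow> continuous_on \<Xi> (g x)"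
  by (rule continuous_on_compose2[OF cont, of _ "\<lambda>t. (x, t)", simplified]) (auto intro!: continuous_intros)

lemma sets_sat: "x \<in> X \<Longrightarrow> sat x \<in> events"
proof -
  assume "x \<in> X"
  then have "closed (\<Xi> \<inter> g x -` {..0})"
    by (intro continuous_closed_preimage cont_t closed_Xi closed_atMost)
  moreover have "\<Xi> \<inter> g x -` {..0} = sat x" by (auto simp: sat_def)
  ultimately show ?thesis by (simp add: sets_L)
qed

text \<open>The key to uniformity in \<open>x\<close>: up to an event of small probability, the sign of \<open>g x t\<close> is the same for
all \<open>x\<close> in a neighbourhood of \<open>x0\<close>, with a margin \<open>\<kappa>\<close> left for the width of the smoothing. The exceptional
event consists of the parameters that are far from the origin or for which \<open>g x0 t\<close> is close to
\<open>0\<close>. These events decrease to the null event \<open>g x0 t = 0\<close>, so their probabilities tend to \<open>0\<close>;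
and on the compact set of parameters that are not far from the origin, \<open>g\<close> is uniformly continuous.\<close>

lemma exceptional_set:
  assumes x0: "x0 \<in> X" and eta: "\<eta> > 0"
  obtains B \<kappa> r where "B \<in> events" "prob B < \<eta>" "\<kappa> > 0" "r > 0"
    "\<And>x t. x \<in> X \<Longrightarrow> dist x x0 < r \<Longrightarrow> t \<in> \<Xi> \<Longrightarrow> t \<notin> B \<Longrightarrow>
       g x0 t \<le> 0 \<and> g x t < - \<kappa> \<or> g x0 t > 0 \<and> g x t > \<kappa>"
proof -
  define a where "a k = inverse (real (Suc k))" for k
  define B where "B k = {t\<in>\<Xi>. \<bar>g x0 t\<bar> \<le> 2 * a k \<or> real k < norm t}" for k
  have sets_B: "B k \<in> events" for k
  proof -
    have "closed (\<Xi> \<inter> g x0 -` {- 2 * a k..2 * a k})"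
      by (intro continuous_closed_preimage cont_t closed_Xi closed_atLeastAtMost x0)
    moreover have "open {t::'s. real k < norm t}" by (intro open_Collect_less continuous_intros)
    moreover have "B k = \<Xi> \<inter> g x0 -` {- 2 * a k..2 * a k} \<union> \<Xi> \<inter> {t. real k < norm t}"
      by (auto simp: B_def abs_le_iff)
    ultimately show ?thesis using closed_Xi by (auto simp: sets_L)
  qed
  have a_mono: "a n \<le> a m" if "m \<le> n" for m n using that by (simp add: a_def field_simps)
  have "decseq B"
  proof (intro decseq_SucI subsetI)
    fix k t assume "t \<in> B (Suc k)"
    then show "t \<in> B k" using a_mono[of k "Suc k"] by (auto simp: B_def)
  qed
  moreover have "(\<Inter>k. B k) = {t\<in>\<Xi>. g x0 t = 0}"
  proof (intro subset_antisym subsetI)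
    fix t assume t: "t \<in> (\<Inter>k. B k)"
    have "g x0 t = 0"
    proof (rule ccontr)
      assume "g x0 t \<noteq> 0"
      then obtain m where m: "a m < \<bar>g x0 t\<bar> / 2"
        using reals_Archimedean[of "\<bar>g x0 t\<bar> / 2"] by (auto simp: a_def)
      obtain n where n: "norm t \<le> real n" using real_arch_simple by blast
      have "t \<in> B (max m n)" using t by blast
      then show False using m n a_mono[of m "max m n"] by (auto simp: B_def)
    qed
    then show "t \<in> {t\<in>\<Xi>. g x0 t = 0}" using t by (auto simp: B_def)
  qed (auto simp: B_def a_def)
  ultimately have "(\<lambda>k. prob (B k)) \<longlonglongrightarrow> 0"
    using finite_Lim_measure_decseq[of B] sets_B null[OF x0] by auto
  then have "\<forall>\<^sub>F k in sequentially. prob (B k) < \<eta>" by (rule order_tendstoD) (rule eta)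
  then obtain k where k: "prob (B k) < \<eta>" by (auto simp: eventually_sequentially)
  have a: "a k > 0" by (simp add: a_def)
  \<comment> \<open>Off \<open>B k\<close> the margin at \<open>x0\<close> exceeds \<open>2 * a k\<close>; a change by less than \<open>a k\<close> leaves more than \<open>a k\<close>.\<close>
  have "compact (X \<times> (\<Xi> \<inter> cball 0 (real k)))"
    by (intro compact_Times compact_X closed_Int_compact closed_Xi compact_cball)
  then have "uniformly_continuous_on (X \<times> (\<Xi> \<inter> cball 0 (real k))) (\<lambda>(x, t). g x t)"
    by (intro compact_uniformly_continuous continuous_on_subset[OF cont]) auto
  then obtain r where r: "r > 0" "\<And>p q. p \<in> X \<times> (\<Xi> \<inter> cball 0 (real k)) \<Longrightarrow>
      q \<in> X \<times> (\<Xi> \<inter> cball 0 (real k)) \<Longrightarrow> dist q p < r \<Longrightarrow>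
      dist (case q of (x, t) \<Rightarrow> g x t) (case p of (x, t) \<Rightarrow> g x t) < a k"
    using a unfolding uniformly_continuous_on_def by metis
  show ?thesis
  proof (rule that[OF sets_B[of k] k a r(1)])
    fix x t assume x: "x \<in> X" "dist x x0 < r" and t: "t \<in> \<Xi>" "t \<notin> B k"
    then have big: "\<bar>g x0 t\<bar> > 2 * a k" and nt: "norm t \<le> real k" by (auto simp: B_def)
    have "dist (g x t) (g x0 t) < a k"
      using r(2)[of "(x0, t)" "(x, t)"] x x0 t nt by (auto simp: dist_Pair_Pair)
    then show "g x0 t \<le> 0 \<and> g x t < - a k \<or> g x0 t > 0 \<and> g x t > a k"
      using big a by (auto simp: dist_real_def)
  qed
qed

lemma prob_sat_close:
  assumes x: "x \<in> X" "x0 \<in> X" and B: "B \<in> events"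
    and agree: "\<And>t. t \<in> \<Xi> \<Longrightarrow> t \<notin> B \<Longrightarrow> g x0 t \<le> 0 \<longleftrightarrow> g x t \<le> 0"
  shows "\<bar>prob (sat x) - prob (sat x0)\<bar> \<le> prob B"
proof -
  have "prob (sat x) \<le> prob (sat x0 \<union> B)" "prob (sat x0) \<le> prob (sat x \<union> B)"
    by (intro finite_measure_mono sets.Un sets_sat x B; use agree in \<open>auto simp: sat_def\<close>)+
  moreover have "prob (sat x0 \<union> B) \<le> prob (sat x0) + prob B" "prob (sat x \<union> B) \<le> prob (sat x) + prob B"
    by (intro measure_Un_le sets_sat x B)+
  ultimately show ?thesis by linarith
qed

lemma continuous_on_prob_sat: "continuous_on X (\<lambda>x. prob (sat x))"
  unfolding continuous_on_iff
proof (intro ballI allI impI)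
  fix x0 e assume x0: "x0 \<in> X" and e: "(0::real) < e"
  obtain B \<kappa> r where B: "B \<in> events" "prob B < e" "\<kappa> > 0" "r > 0"
    "\<And>x t. x \<in> X \<Longrightarrow> dist x x0 < r \<Longrightarrow> t \<in> \<Xi> \<Longrightarrow> t \<notin> B \<Longrightarrow>
       g x0 t \<le> 0 \<and> g x t < - \<kappa> \<or> g x0 t > 0 \<and> g x t > \<kappa>"
    by (rule exceptional_set[OF x0 e]) blast
  have "dist (prob (sat x)) (prob (sat x0)) < e" if "x \<in> X" "dist x x0 < r" for x
  proof -
    have "\<bar>prob (sat x) - prob (sat x0)\<bar> \<le> prob B"
      by (intro prob_sat_close that x0 B(1)) (use B(3) B(5)[OF that] in force)
    then show ?thesis using B(2) by (simp add: dist_real_def)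
  qed
  then show "\<exists>d>0. \<forall>x'\<in>X. dist x' x0 < d \<longrightarrow> dist (prob (sat x')) (prob (sat x0)) < e"
    using B(4) by blast
qed

text \<open>A uniform strong law. Compactness provides finitely many \<open>x0\<close> whose neighbourhoods from
the preceding construction cover \<open>X\<close>. On the neighbourhood of \<open>x0\<close>, and for a smoothing narrower than
the margin, the smoothed indicator of \<open>g x t \<le> 0\<close> agrees with the exact indicator of \<open>g x0 t \<le> 0\<close> outside the
exceptional event. So the strong law is needed only for the finitely many events \<open>sat x0\<close> and
their exceptional events, and it controls all \<open>x\<close> and all small \<open>e\<close> at once; this is why \<open>N\<close> and \<open>e\<close> may tend to
their limits jointly and at unrelated rates.\<close>

theorem AE_smoothed_frequency_uniform:
  fixes S :: "real \<Rightarrow> real \<Rightarrow> real" and M :: "'w measure" and Y :: "nat \<Rightarrow> 'w \<Rightarrow> 's"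
  assumes M: "prob_space M" and indep: "prob_space.indep_vars M (\<lambda>_. borel) Y UNIV"
    and distr: "\<And>j. distr M borel (Y j) = L"
    and vals: "\<And>j \<omega>. \<omega> \<in> space M \<Longrightarrow> Y j \<omega> \<in> \<Xi>"
    and S: "\<And>e y. e > 0 \<Longrightarrow> S e y \<in> {0..1}" "\<And>e y. e > 0 \<Longrightarrow> y \<ge> e \<Longrightarrow> S e y = 0"
      "\<And>e y. e > 0 \<Longrightarrow> y \<le> - e \<Longrightarrow> S e y = 1"
  shows "AE \<omega> in M. \<forall>\<eta>>0. \<forall>\<^sub>F (N, e) in sequentially \<times>\<^sub>F at_right 0.
    \<forall>x\<in>X. \<bar>(\<Sum>j<N. S e (g x (Y j \<omega>))) / real N - prob (sat x)\<bar> \<le> \<eta>"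
proof -
  interpret M: prob_space M by (rule M)
  have Y[measurable]: "Y j \<in> M \<rightarrow>\<^sub>M borel" for j using indep unfolding M.indep_vars_def by auto
  have freq: "AE \<omega> in M. (\<lambda>n. (\<Sum>j<n. indicator A (Y j \<omega>)) / real n) \<longlonglongrightarrow> prob A" if A: "A \<in> events" for A
  proof (rule M.AE_frequency_tendsto[OF indep])
    show "A \<in> sets borel" using A by (simp add: sets_L)
    then show "M.prob (Y j -` A \<inter> space M) = prob A" for j
      using measure_distr[OF Y[of j], of A] by (simp add: distr)
  qed
  \<comment> \<open>The error is at most \<open>2 * \<eta>\<close> from the frequency of \<open>B x0\<close>, \<open>\<eta>\<close> from that of \<open>sat x0\<close>,\<close>
  \<comment> \<open>and \<open>\<eta>\<close> from replacing the probability of \<open>sat x\<close> by that of \<open>sat x0\<close>.\<close>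
  have fixed_eta: "AE \<omega> in M. \<forall>\<^sub>F (N, e) in sequentially \<times>\<^sub>F at_right 0.
    \<forall>x\<in>X. \<bar>(\<Sum>j<N. S e (g x (Y j \<omega>))) / real N - prob (sat x)\<bar> \<le> 4 * \<eta>" if eta: "\<eta> > 0" for \<eta>
  proof -
    define Q where "Q x0 B \<kappa> r \<longleftrightarrow> B \<in> events \<and> prob B < \<eta> \<and> (0::real) < \<kappa> \<and> (0::real) < r \<and>
      (\<forall>x t. x \<in> X \<longrightarrow> dist x x0 < r \<longrightarrow> t \<in> \<Xi> \<longrightarrow> t \<notin> B \<longrightarrow>
       g x0 t \<le> 0 \<and> g x t < - \<kappa> \<or> g x0 t > 0 \<and> g x t > \<kappa>)" for x0 B \<kappa> r
    have "\<exists>B \<kappa> r. Q x0 B \<kappa> r" if "x0 \<in> X" for x0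
      unfolding Q_def by (rule exceptional_set[OF that eta]) blast
    then obtain B \<kappa> r where Q: "\<And>x0. x0 \<in> X \<Longrightarrow> Q x0 (B x0) (\<kappa> x0) (r x0)" by metis
    have B: "B x0 \<in> events" "prob (B x0) < \<eta>" "0 < \<kappa> x0" "0 < r x0" if "x0 \<in> X" for x0
      using Q[OF that] unfolding Q_def by blast+
    have separated: "g x0 t \<le> 0 \<and> g x t < - \<kappa> x0 \<or> g x0 t > 0 \<and> g x t > \<kappa> x0"
      if "x0 \<in> X" "x \<in> X" "dist x x0 < r x0" "t \<in> \<Xi>" "t \<notin> B x0" for x0 x t
      using Q[OF that(1)] that(2-) unfolding Q_def by blast
    obtain F where F: "F \<subseteq> X" "finite F" "X \<subseteq> (\<Union>x0\<in>F. ball x0 (r x0))"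
    proof (rule compactE_image[OF compact_X, of X "\<lambda>x0. ball x0 (r x0)"])
      show "X \<subseteq> (\<Union>x0\<in>X. ball x0 (r x0))" using B(4) by force
    qed (auto intro: that)
    have "AE \<omega> in M. \<forall>x0\<in>F. (\<lambda>n. (\<Sum>j<n. indicator (sat x0) (Y j \<omega>)) / real n) \<longlonglongrightarrow> prob (sat x0) \<and>
        (\<lambda>n. (\<Sum>j<n. indicator (B x0) (Y j \<omega>)) / real n) \<longlonglongrightarrow> prob (B x0)"
    proof (rule AE_finite_allI[OF F(2)])
      fix x0 assume "x0 \<in> F"
      then have "sat x0 \<in> events" "B x0 \<in> events" using F(1) sets_sat B(1) by auto
      from freq[OF this(1)] freq[OF this(2)]
      show "AE \<omega> in M. (\<lambda>n. (\<Sum>j<n. indicator (sat x0) (Y j \<omega>)) / real n) \<longlonglongrightarrow> prob (sat x0) \<and>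
        (\<lambda>n. (\<Sum>j<n. indicator (B x0) (Y j \<omega>)) / real n) \<longlonglongrightarrow> prob (B x0)"
        by eventually_elim simp
    qed
    then show ?thesis using AE_space
    proof eventually_elim
      case (elim \<omega>)
      define fA where "fA n x0 = (\<Sum>j<n. indicator (sat x0) (Y j \<omega>)) / real n" for n x0
      define fB where "fB n x0 = (\<Sum>j<n. indicator (B x0) (Y j \<omega>)) / real n" for n x0
      have "\<forall>\<^sub>F n in sequentially. \<bar>fA n x0 - prob (sat x0)\<bar> < \<eta> \<and> fB n x0 < 2 * \<eta>" if x0: "x0 \<in> F" for x0
      proof -
        have "(\<lambda>n. fA n x0) \<longlonglongrightarrow> prob (sat x0)" "(\<lambda>n. fB n x0) \<longlonglongrightarrow> prob (B x0)"
          using elim(1) x0 unfolding fA_def fB_def by auto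
        moreover have "prob (B x0) < 2 * \<eta>" using B(2)[of x0] x0 F(1) eta by force
        ultimately have "\<forall>\<^sub>F n in sequentially. dist (fA n x0) (prob (sat x0)) < \<eta>"
          "\<forall>\<^sub>F n in sequentially. fB n x0 < 2 * \<eta>"
          using eta by (auto dest: tendstoD order_tendstoD)
        then show ?thesis by eventually_elim (simp add: dist_real_def)
      qed
      then have large_N: "\<forall>\<^sub>F n in sequentially. \<forall>x0\<in>F. \<bar>fA n x0 - prob (sat x0)\<bar> < \<eta> \<and> fB n x0 < 2 * \<eta>"
        by (intro eventually_ball_finite F(2)) auto
      have small_e: "\<forall>\<^sub>F e in at_right 0. 0 < e \<and> (\<forall>x0\<in>F. e < \<kappa> x0)"
      proof (intro eventually_conj eventually_ball_finite F(2) ballI)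
        show "\<forall>\<^sub>F e in at_right (0::real). 0 < e" by (rule eventually_at_right_less)
        show "\<forall>\<^sub>F e in at_right 0. e < \<kappa> x0" if "x0 \<in> F" for x0
          using B(3) that F(1) by (auto intro!: eventually_at_rightI[of 0 "\<kappa> x0"])
      qed
      have "\<bar>(\<Sum>j<n. S e (g x (Y j \<omega>))) / real n - prob (sat x)\<bar> \<le> 4 * \<eta>"
        if n: "\<forall>x0\<in>F. \<bar>fA n x0 - prob (sat x0)\<bar> < \<eta> \<and> fB n x0 < 2 * \<eta>"
          and e: "0 < e" "\<forall>x0\<in>F. e < \<kappa> x0" and x: "x \<in> X" for n e x
      proof -
        obtain x0 where x0: "x0 \<in> F" "dist x x0 < r x0" using F(3) x by (auto simp: dist_commute)
        have x0X: "x0 \<in> X" using x0 F(1) by auto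
        note sign = separated[OF x0X x x0(2)]
        have e\<kappa>: "e < \<kappa> x0" using e(2) x0(1) by blast
        have pointwise: "\<bar>S e (g x t) - indicator (sat x0) t\<bar> \<le> indicator (B x0) t" if t: "t \<in> \<Xi>" for t
        proof (cases "t \<in> B x0")
          case True
          then show ?thesis using S(1)[OF e(1), of "g x t"] by (auto split: split_indicator)
        next
          case False
          then show ?thesis using sign[OF t False] S(2,3)[OF e(1), of "g x t"] e\<kappa> t
            by (auto simp: sat_def split: split_indicator)
        qed
        have "(\<Sum>j<n. S e (g x (Y j \<omega>))) / real n - fA n x0 =
            (\<Sum>j<n. S e (g x (Y j \<omega>)) - indicator (sat x0) (Y j \<omega>)) / real n"
          unfolding fA_def by (simp add: sum_subtractf diff_divide_distrib)
        also have "\<bar>\<dots>\<bar> \<le> fB n x0"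
          unfolding fB_def abs_divide abs_of_nat
          by (intro divide_right_mono order_trans[OF sum_abs] sum_mono pointwise vals elim(2)) auto
        finally have 1: "\<bar>(\<Sum>j<n. S e (g x (Y j \<omega>))) / real n - fA n x0\<bar> \<le> fB n x0" .
        have "\<bar>prob (sat x) - prob (sat x0)\<bar> \<le> prob (B x0)"
          by (intro prob_sat_close x x0X B(1)) (use B(3)[OF x0X] sign in force)
        then show ?thesis using 1 n x0(1) B(2)[OF x0X] by (fastforce simp: abs_le_iff abs_less_iff)
      qed
      then show ?case unfolding eventually_prod_filter
        using large_N small_e by (intro exI conjI allI impI) (assumption | force)+
    qed
  qed
  have "AE \<omega> in M. \<forall>k. \<forall>\<^sub>F (N, e) in sequentially \<times>\<^sub>F at_right 0.
    \<forall>x\<in>X. \<bar>(\<Sum>j<N. S e (g x (Y j \<omega>))) / real N - prob (sat x)\<bar> \<le> 4 * inverse (real (Suc k))"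
    unfolding AE_all_countable by (intro allI fixed_eta) simp
  then show ?thesis
  proof eventually_elim
    case (elim \<omega>)
    show ?case
    proof (intro allI impI)
      fix \<eta> :: real assume "\<eta> > 0"
      then obtain k where k: "inverse (real (Suc k)) < \<eta> / 4" using reals_Archimedean[of "\<eta> / 4"] by auto
      then have le: "4 * inverse (real (Suc k)) \<le> \<eta>" by linarith
      from elim[THEN spec, of k] show "\<forall>\<^sub>F (N, e) in sequentially \<times>\<^sub>F at_right 0.
        \<forall>x\<in>X. \<bar>(\<Sum>j<N. S e (g x (Y j \<omega>))) / real N - prob (sat x)\<bar> \<le> \<eta>"
      proof (rule eventually_mono, clarify)
        fix N e x assume "\<forall>x\<in>X. \<bar>(\<Sum>j<N. S e (g x (Y j \<omega>))) / real N - prob (sat x)\<bar> \<le> 4 * inverse (real (Suc k))" "x \<in> X"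
        then show "\<bar>(\<Sum>j<N. S e (g x (Y j \<omega>))) / real N - prob (sat x)\<bar> \<le> \<eta>" using le by (blast intro: order_trans)
      qed
    qed
  qed
qed

end

section \<open>Convergence of the sample-based two-point problems\<close>

lemma continuous_on_Max_image:
  fixes f :: "'i \<Rightarrow> 'a::topological_space \<Rightarrow> real"
  assumes "finite I" "I \<noteq> {}" "\<And>i. i \<in> I \<Longrightarrow> continuous_on S (f i)"
  shows "continuous_on S (\<lambda>x. Max ((\<lambda>i. f i x) ` I))"
  using assms
proof (induction I rule: finite_ne_induct)
  case (insert i I)
  then show ?case by (simp add: continuous_on_max)
qed simp

lemma continuous_on_hbar:
  fixes h :: "'x::topological_space \<Rightarrow> real ^ 's::finite \<Rightarrow> real ^ 'm::finite"
  assumes "continuous_on (X \<times> \<Xi>) (\<lambda>(x, t). h x t)"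
  shows "continuous_on (X \<times> \<Xi>) (\<lambda>(x, t). hbar h x t)"
  unfolding hbar_def case_prod_beta
  using assms unfolding case_prod_beta
  by (intro continuous_on_Max_image continuous_intros) auto

text \<open>The satisfaction probability is defined as an integral against \<open>p\<close>, but the uniform strong law is about
the probability of an event under the law of the samples.\<close>

lemma sat_prob_eq_measure:
  fixes h :: "'x \<Rightarrow> real ^ 's::finite \<Rightarrow> real ^ 'm::finite"
  assumes p_nonneg: "\<And>t. t \<in> \<Xi> \<Longrightarrow> p t \<ge> 0"
    and dens: "dens \<Xi> p \<in> borel_measurable lborel"
    and A: "{t\<in>\<Xi>. hbar h x t \<le> 0} \<in> sets borel"
  shows "sat_prob \<Xi> p h x = measure (law \<Xi> p) {t\<in>\<Xi>. hbar h x t \<le> 0}"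
proof -
  let ?A = "{t\<in>\<Xi>. hbar h x t \<le> 0}"
  note [measurable] = dens A
  have "measure (law \<Xi> p) ?A = enn2real (\<integral>\<^sup>+t. dens \<Xi> p t * indicator ?A t \<partial>lborel)"
    unfolding measure_def law_def by (subst emeasure_density) auto
  also have "(\<integral>\<^sup>+t. dens \<Xi> p t * indicator ?A t \<partial>lborel) =
      (\<integral>\<^sup>+t. ennreal (enn2real (dens \<Xi> p t * indicator ?A t)) \<partial>lborel)"
    by (rule nn_integral_cong) (auto simp: dens_def split: split_indicator)
  also have "enn2real \<dots> = (LINT t|lborel. enn2real (dens \<Xi> p t * indicator ?A t))"
    by (subst integral_eq_nn_integral) auto
  also have "\<dots> = sat_prob \<Xi> p h x"
    unfolding sat_prob_def set_lebesgue_integral_def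
    by (rule Bochner_Integration.integral_cong)
       (auto simp: dens_def le0_ind_def p_nonneg split: split_indicator)
  finally show ?thesis by simp
qed

lemma smooth_step_bounds:
  assumes "smoothing_family lam" "\<epsilon> > 0"
  shows "smooth_step lam \<epsilon> y \<in> {0..1}"
    and "y \<ge> \<epsilon> \<Longrightarrow> smooth_step lam \<epsilon> y = 0"
    and "y \<le> - \<epsilon> \<Longrightarrow> smooth_step lam \<epsilon> y = 1"
proof -
  have "lam \<epsilon> ` {-\<epsilon>..\<epsilon>} \<subseteq> {0..1}" using assms unfolding smoothing_family_def by blast
  then have "lam \<epsilon> y \<in> {0..1}" if "- \<epsilon> < y" "y < \<epsilon>"
    using that by (intro subsetD[OF \<open>lam \<epsilon> ` {-\<epsilon>..\<epsilon>} \<subseteq> {0..1}\<close>] imageI) auto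
  then show "smooth_step lam \<epsilon> y \<in> {0..1}" unfolding smooth_step_def by auto
qed (use assms(2) in \<open>auto simp: smooth_step_def\<close>)

lemma continuous_on_sample_prob:
  fixes h :: "'x::topological_space \<Rightarrow> real ^ 's::finite \<Rightarrow> real ^ 'm::finite"
  assumes lam: "smoothing_family lam" and eps: "\<epsilon> > 0"
    and h: "continuous_on (X \<times> \<Xi>) (\<lambda>(x, t). h x t)" and s: "\<And>j. s j \<in> \<Xi>"
  shows "continuous_on X (sample_prob lam h \<gamma> \<epsilon> N s)"
proof -
  have "smooth_step lam \<epsilon> C1_differentiable_on UNIV"
    using lam eps unfolding smoothing_family_def by blast
  then have step: "continuous_on UNIV (smooth_step lam \<epsilon>)"
    by (rule C1_differentiable_imp_continuous_on)
  have "continuous_on X (\<lambda>x. hbar h x (s j))" for j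
    by (rule continuous_on_compose2[OF continuous_on_hbar[OF h], of _ "\<lambda>x. (x, s j)", simplified])
       (auto intro!: continuous_intros s)
  then show ?thesis unfolding sample_prob_def
    by (intro continuous_intros continuous_on_compose2[OF step]) auto
qed

theorem theorem3:
  fixes X :: "(real ^ 'n::finite) set"
    and J :: "real ^ 'n \<Rightarrow> real"
    and \<Xi> :: "(real ^ 's::finite) set"
    and p :: "real ^ 's \<Rightarrow> real"
    and h :: "real ^ 'n \<Rightarrow> real ^ 's \<Rightarrow> real ^ 'm::finite"
    and lam :: "real \<Rightarrow> real \<Rightarrow> real"
    and M :: "'w measure"
    and \<xi> :: "nat \<Rightarrow> 'w \<Rightarrow> real ^ 's"
    and \<alpha> \<gamma> :: real
  defines "P \<equiv> sat_prob \<Xi> p h"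
  assumes X: "compact X"
    and J: "continuous_on X J"
    and p_cont: "continuous_on \<Xi> p"
    and p_nonneg: "\<And>t. t \<in> \<Xi> \<Longrightarrow> p t \<ge> 0"
    and p_prob: "prob_space (law \<Xi> p)"
    and p_supp: "supp \<Xi> p = \<Xi>"
    and h: "continuous_on (X \<times> \<Xi>) (\<lambda>(x, t). h x t)"
    and lam: "smoothing_family lam"
    and M: "prob_space M"
    and sample_vals: "\<And>j \<omega>. \<omega> \<in> space M \<Longrightarrow> \<xi> j \<omega> \<in> \<Xi>"
    and sample_law: "\<And>j. distributed M lborel (\<xi> j) (dens \<Xi> p)"
    and sample_indep: "prob_space.indep_vars M (\<lambda>_. borel) \<xi> UNIV"
    and alpha: "0 \<le> \<alpha>" "\<alpha> \<le> 1"
    and feas: "feasible X P \<alpha> \<noteq> {}"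
    and null: "\<And>x. x \<in> X \<Longrightarrow> measure (law \<Xi> p) {t \<in> supp \<Xi> p. hbar h x t = 0} = 0"
    and approx_measure:
      "\<exists>\<mu>star \<in> opt_measures X J P \<alpha>. \<forall>\<delta>>0. \<exists>\<mu> \<in> prob_measures_on X. \<mu> \<noteq> \<mu>star \<and>
         (LINT x|\<mu>. P x) > 1 - \<alpha> \<and> \<bar>(LINT x|\<mu>. J x) - (LINT x|\<mu>star. J x)\<bar> \<le> \<delta>"
    and approx_point:
      "\<And>\<beta>. 0 < \<beta> \<Longrightarrow> \<beta> \<le> 1 \<Longrightarrow>
         \<exists>xbar \<in> minimizers J (feasible X P \<beta>).
           \<forall>\<eta>>0. \<exists>x\<in>X. norm (x - xbar) \<le> \<eta> \<and> P x > 1 - \<beta>"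
    and gamma: "\<gamma> = 0"
  shows "AE \<omega> in M.
      ((\<lambda>(N, \<epsilon>). two_point_val X J (sample_prob lam h \<gamma> \<epsilon> N (\<lambda>j. \<xi> j \<omega>)) \<alpha>)
         \<longlongrightarrow> opt_measure_val X J P \<alpha>) (sequentially \<times>\<^sub>F at_right 0)
    \<and> ((\<lambda>(N, \<epsilon>). deviation
            (two_point_minimizers X J (sample_prob lam h \<gamma> \<epsilon> N (\<lambda>j. \<xi> j \<omega>)) \<alpha>)
            (two_point_minimizers X J P \<alpha>))
         \<longlongrightarrow> 0) (sequentially \<times>\<^sub>F at_right 0)"
proof -
  have closed_Xi: "closed \<Xi>" using p_supp unfolding supp_def by (metis closed_closure)
  interpret L: prob_space "law \<Xi> p" by (rule p_prob)
  interpret L: null_level_family "law \<Xi> p" X \<Xi> "hbar h"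
  proof unfold_locales
    show "sets (law \<Xi> p) = sets borel" by (simp add: law_def)
    show "L.prob {t \<in> \<Xi>. hbar h x t = 0} = 0" if "x \<in> X" for x
      using null[OF that] unfolding p_supp .
  qed (intro X closed_Xi continuous_on_hbar h)+
  have P_eq: "P x = L.prob (L.sat x)" if "x \<in> X" for x
    unfolding P_def L.sat_def
    by (rule sat_prob_eq_measure[OF p_nonneg distributed_borel_measurable[OF sample_law[of 0]]])
       (use L.sets_sat[OF that] in \<open>auto simp: L.sat_def L.sets_L\<close>)
  have P: "continuous_on X P"
    using L.continuous_on_prob_sat P_eq by (simp cong: continuous_on_cong)
  have distr: "distr M borel (\<xi> j) = law \<Xi> p" for j
  proof -
    have "distr M borel (\<xi> j) = distr M lborel (\<xi> j)" by (rule distr_cong) auto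
    then show ?thesis
      using distributed_distr_eq_density[OF sample_law[of j]] by (simp add: law_def)
  qed

  \<comment> \<open>The measure that shows near-optimality with slack is traded for a two-point element with\<close>
  \<comment> \<open>the same slack and no larger cost; this is the strict feasibility that stability requires.\<close>
  obtain \<mu>star where mustar: "\<mu>star \<in> opt_measures X J P \<alpha>" "\<And>\<delta>. \<delta> > 0 \<Longrightarrow>
      \<exists>\<mu> \<in> prob_measures_on X. (LINT x|\<mu>. P x) > 1 - \<alpha> \<and>
         \<bar>(LINT x|\<mu>. J x) - (LINT x|\<mu>star. J x)\<bar> \<le> \<delta>"
    using approx_measure by blast
  define v where "v = (LINT x|\<mu>star. J x)"
  have opt: "opt_measure_val X J P \<alpha> = ereal v" using mustar(1) by (simp add: opt_measures_def v_def)
  have lower: "v \<le> two_point_mean J z" if "z \<in> two_points X" "two_point_mean P z \<ge> 1 - \<alpha>" for z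
  proof -
    have "two_point_val X J P \<alpha> \<le> ereal (two_point_mean J z)"
      unfolding two_point_val_def by (rule INF_lower) (use that in \<open>simp add: two_point_feasible_def\<close>)
    then show ?thesis using opt opt_measure_val_eq_two_point_val[OF X J P, of \<alpha>] by simp
  qed
  have strict: "\<exists>z\<in>two_points X. two_point_mean P z > 1 - \<alpha> \<and> two_point_mean J z \<le> v + \<delta>"
    if delta: "\<delta> > 0" for \<delta>
  proof -
    obtain \<mu> where mu: "\<mu> \<in> prob_measures_on X" "(LINT x|\<mu>. P x) > 1 - \<alpha>"
      "\<bar>(LINT x|\<mu>. J x) - v\<bar> \<le> \<delta>"
      using mustar(2)[OF delta] unfolding v_def by blast
    from measure_dominated_by_two_point[OF X J P mu(1)] show ?thesis
      by (rule bexE, intro bexI) (use mu in auto)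
  qed

  let ?F = "sequentially \<times>\<^sub>F at_right (0::real)"
  have "AE \<omega> in M. \<forall>\<eta>>0. \<forall>\<^sub>F (N, \<epsilon>) in ?F. \<forall>x\<in>X.
      \<bar>(\<Sum>j<N. smooth_step lam \<epsilon> (hbar h x (\<xi> j \<omega>))) / real N - L.prob (L.sat x)\<bar> \<le> \<eta>"
    by (rule L.AE_smoothed_frequency_uniform[OF M sample_indep distr sample_vals])
       (use smooth_step_bounds[OF lam] in auto)
  then show ?thesis using AE_space
  proof eventually_elim
    case (elim \<omega>)
    let ?Pn = "\<lambda>N \<epsilon>. sample_prob lam h \<gamma> \<epsilon> N (\<lambda>j. \<xi> j \<omega>)"
    define gn where "gn i = two_point_mean (?Pn (fst i) (snd i))" for i
    have pos: "\<forall>\<^sub>F i in ?F. snd i > 0"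
      unfolding eventually_prod_filter
      by (intro exI[of _ "\<lambda>_. True"] exI[of _ "\<lambda>\<epsilon>. \<epsilon> > 0"]) (simp add: eventually_at_right_less)
    have gn_cont: "\<forall>\<^sub>F i in ?F. continuous_on (two_points X) (gn i)"
      using pos
    proof eventually_elim
      case (elim i)
      then show ?case unfolding gn_def
        by (intro continuous_on_two_point_mean continuous_on_sample_prob[OF lam _ h] sample_vals \<open>\<omega> \<in> space M\<close>)
    qed
    have gn_unif: "\<forall>\<^sub>F i in ?F. \<forall>z\<in>two_points X. \<bar>gn i z - two_point_mean P z\<bar> \<le> \<eta>" if eta: "\<eta> > 0" for \<eta>
    proof -
      have "\<forall>\<^sub>F (N, \<epsilon>) in ?F. \<forall>x\<in>X.
        \<bar>(\<Sum>j<N. smooth_step lam \<epsilon> (hbar h x (\<xi> j \<omega>))) / real N - L.prob (L.sat x)\<bar> \<le> \<eta>"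
        using elim(1) eta by blast
      then show ?thesis
      proof (rule eventually_mono, intro ballI)
        fix i z
        assume close: "case i of (N, \<epsilon>) \<Rightarrow> \<forall>x\<in>X.
          \<bar>(\<Sum>j<N. smooth_step lam \<epsilon> (hbar h x (\<xi> j \<omega>))) / real N - L.prob (L.sat x)\<bar> \<le> \<eta>"
          and z: "z \<in> two_points X"
        show "\<bar>gn i z - two_point_mean P z\<bar> \<le> \<eta>"
          unfolding gn_def
        proof (rule two_point_mean_diff_le[OF z])
          fix x assume "x \<in> X"
          then show "\<bar>?Pn (fst i) (snd i) x - P x\<bar> \<le> \<eta>"
            using close P_eq unfolding sample_prob_def gamma case_prod_beta by simp
        qed
      qed
    qed
    note stability = perturbed_constraint_stability[OF compact_two_points[OF X]
        continuous_on_two_point_mean[OF J] continuous_on_two_point_mean[OF P]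
        gn_cont gn_unif strict lower]
    show ?case
      unfolding two_point_minimizers_def two_point_val_def two_point_feasible_def case_prod_beta opt
      by (rule conjI; rule stability[unfolded gn_def])
  qed
qed

end
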